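(* Let $n\ge1$ be an integer, $1<q\le2$, $2\ge q>q_1>\cdots>q_n>1$, let $A,B,\eta_1,\eta_2\in\mathbb R$ with $A\ne0$, and let $f:[0,1]\times\mathbb R^{n+1}\to\mathbb R$ be continuous. For $v\in C[0,1]$ put $$b_1=b_1(v)=-\int_0^1\Big[\frac{B(1-s)^{q-1}}{A\,\Gamma(q)}+\frac{B^2(1-s)^{q-2}}{A^2\,\Gamma(q-1)}\Big]v(s)\,ds-\frac{(A+B)\eta_1-B\eta_2}{A^2},$$ $$b_2=b_2(v)=\int_0^1\Big[\frac{(1-s)^{q-1}}{\Gamma(q)}+\frac{B(1-s)^{q-2}}{A\,\Gamma(q-1)}\Big]v(s)\,ds-\frac{\eta_2-\eta_1}{A}.$$ If $v\in C[0,1]$ is a solution of $$v(t)=f\big(t,\;I^qv(t)-b_1-b_2t,\;I^{q-q_1}v(t),\dots,I^{q-q_n}v(t)\big),\qquad t\in[0,1],$$ then the function $$x(t)=I^qv(t)+\int_0^1\Big[\frac{(B-At)(1-s)^{q-1}}{A\,\Gamma(q)}+\frac{B(B-At)(1-s)^{q-2}}{A^2\,\Gamma(q-1)}\Big]v(s)\,ds+\frac1{A^2}\big[(A(1-t)+B)\eta_1+(-B+At)\eta_2\big]$$ is a solution of the boundary value problem $$D_*^qx(t)=f\big(t,x(t),D_*^{q_1}x(t),\dots,D_*^{q_n}x(t)\big),\quad 0<t<1,$$ $$A\,x(0)+B\,x'(0)=\eta_1,\qquad A\,x(1)+B\,x'(1)=\eta_2 .$$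
   Context: For $\beta>0$, $I^\beta y(t)=\frac1{\Gamma(\beta)}\int_0^t(t-\tau)^{\beta-1}y(\tau)\,d\tau$, and $I^0$ is the identity. For $1<\beta\le2$ and $x\in C^1[0,1]$, the Caputo derivative is $D_*^\beta x(t)=\frac{d^2}{dt^2}I^{2-\beta}\big(x(t)-x(0)-x'(0)t\big)$ (which for $x\in C^2[0,1]$ equals $I^{2-\beta}x''(t)$). A solution of the boundary value problem is a function $x\in C^1[0,1]$ with $D_*^qx\in C[0,1]$ satisfying the equation and both boundary conditions. *)

theory Defs
  imports "HOL-Analysis.Analysis"
begin

text \<open>Values at \<^term>\<open>\<beta> < 0\<close> are irrelevant. Since \<^term>\<open>0 powr a = (0::real)\<close>, the integrand is
  \<^term>\<open>0::real\<close> at \<^term>\<open>\<tau> = (t::real)\<close>; this affects a single point only, hence not the integral.\<close>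
definition frac_int :: "real \<Rightarrow> (real \<Rightarrow> real) \<Rightarrow> real \<Rightarrow> real" where
  "frac_int \<beta> y t =
     (if \<beta> = 0 then y t
      else 1 / Gamma \<beta> * integral {0..t} (\<lambda>\<tau>. (t - \<tau>) powr (\<beta> - 1) * y \<tau>))"

text \<open>All functions live on the unit interval, so derivatives are taken relative to it: they are
  ordinary derivatives in the interior and one-sided ones at the end points, and values outside
  the interval play no role.\<close>
definition deriv01 :: "(real \<Rightarrow> real) \<Rightarrow> real \<Rightarrow> real" where
  "deriv01 x t = vector_derivative x (at t within {0..1})"

definition C1_01 :: "(real \<Rightarrow> real) \<Rightarrow> bool" where
  "C1_01 x \<longleftrightarrow> x differentiable_on {0..1} \<and> continuous_on {0..1} (deriv01 x)"

definition caputo_potential :: "real \<Rightarrow> (real \<Rightarrow> real) \<Rightarrow> real \<Rightarrow> real" where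
  "caputo_potential \<beta> x = frac_int (2 - \<beta>) (\<lambda>s. x s - x 0 - deriv01 x 0 * s)"

definition caputo :: "real \<Rightarrow> (real \<Rightarrow> real) \<Rightarrow> real \<Rightarrow> real" where
  "caputo \<beta> x = deriv01 (deriv01 (caputo_potential \<beta> x))"

text \<open>Because \<^const>\<open>vector_derivative\<close> is total, existence of the Caputo derivative at every point
  of a set has to be asserted separately. The set is meant to be relatively open in the unit
  interval, so that the inner derivative exists near each of its points.\<close>
definition caputo_exists_on :: "real \<Rightarrow> (real \<Rightarrow> real) \<Rightarrow> real set \<Rightarrow> bool" where
  "caputo_exists_on \<beta> x S \<longleftrightarrow>
     (\<forall>t\<in>S. caputo_potential \<beta> x differentiable (at t within {0..1}) \<and>
            deriv01 (caputo_potential \<beta> x) differentiable (at t within {0..1}))"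

text \<open>The type variable \<^typ>\<open>'n\<close> stands for the index set $\{1,\dots,n\}$, and $\mathbb R^{n+1}$ is rendered as
  \<^typ>\<open>real \<times> (real ^ 'n)\<close>.\<close>
definition bvp_solution ::
  "real \<Rightarrow> real \<Rightarrow> real \<Rightarrow> real \<Rightarrow> real \<Rightarrow> ('n::finite \<Rightarrow> real) \<Rightarrow>
   (real \<times> real \<times> (real ^ 'n) \<Rightarrow> real) \<Rightarrow> (real \<Rightarrow> real) \<Rightarrow> bool" where
  "bvp_solution A B \<eta>1 \<eta>2 q qs f x \<longleftrightarrow>
     C1_01 x \<and>
     caputo_exists_on q x {0..1} \<and> continuous_on {0..1} (caputo q x) \<and>
     (\<forall>i. caputo_exists_on (qs i) x {0<..<1}) \<and>
     (\<forall>t\<in>{0<..<1}. caputo q x t = f (t, x t, \<chi> i. caputo (qs i) x t)) \<and>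
     A * x 0 + B * deriv01 x 0 = \<eta>1 \<and>
     A * x 1 + B * deriv01 x 1 = \<eta>2"

definition bvp_b1 :: "real \<Rightarrow> real \<Rightarrow> real \<Rightarrow> real \<Rightarrow> real \<Rightarrow> (real \<Rightarrow> real) \<Rightarrow> real" where
  "bvp_b1 A B \<eta>1 \<eta>2 q v =
     - integral {0..1} (\<lambda>s. (B * (1 - s) powr (q - 1) / (A * Gamma q)
                            + B^2 * (1 - s) powr (q - 2) / (A^2 * Gamma (q - 1))) * v s)
     - ((A + B) * \<eta>1 - B * \<eta>2) / A^2"

definition bvp_b2 :: "real \<Rightarrow> real \<Rightarrow> real \<Rightarrow> real \<Rightarrow> real \<Rightarrow> (real \<Rightarrow> real) \<Rightarrow> real" where
  "bvp_b2 A B \<eta>1 \<eta>2 q v =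
     integral {0..1} (\<lambda>s. ((1 - s) powr (q - 1) / Gamma q
                          + B * (1 - s) powr (q - 2) / (A * Gamma (q - 1))) * v s)
     - (\<eta>2 - \<eta>1) / A"

end

theory Submission
  imports Defs
begin

text \<open>With \<open>b1\<close> and \<open>b2\<close> abbreviating the two constants, the function in question is
  \<open>x t = I\<^sup>q v t - b1 - b2 t\<close>, so \<open>x 0 = - b1\<close> and \<open>x' 0 = - b2\<close>. The semigroup law for fractional
  integrals identifies the function differentiated twice in the Caputo derivative of order \<open>\<beta>\<close> as the
  fractional integral of \<open>v\<close> of order \<open>q - \<beta> + 2\<close>. Hence the Caputo derivative of \<open>x\<close> is the fractional
  integral of \<open>v\<close> of order \<open>q - \<beta>\<close>, which turns the equation for \<open>v\<close> into the differential equation;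
  the boundary conditions are two linear equations for \<open>b1\<close> and \<open>b2\<close>.\<close>

section \<open>The weakly singular kernel and the Beta integral\<close>

lemma Gamma_real_nonzero: "0 < x \<Longrightarrow> Gamma x \<noteq> (0::real)"
  by (metis Gamma_real_pos less_irrefl)

text \<open>The substitution \<open>\<tau> = t * u\<close> reduces this to Euler's Beta integral on
  the unit interval; at \<open>t = 0\<close> both sides vanish.\<close>

lemma has_integral_frac_kernel_powr:
  fixes \<beta> c t :: real
  assumes "0 < \<beta>" "0 \<le> c" "0 \<le> t"
  shows "((\<lambda>\<tau>. (t - \<tau>) powr (\<beta> - 1) * \<tau> powr c) has_integral
           t powr (c + \<beta>) * Beta (c + 1) \<beta>) {0..t}"
proof (cases "t = 0")
  case False
  with assms have t: "t > 0" by simp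
  have "((\<lambda>u. u powr (c + 1 - 1) * (1 - u) powr (\<beta> - 1)) has_integral Beta (c + 1) \<beta>) {0..1}"
    by (rule has_integral_Beta_real) (use assms in auto)
  then have "((\<lambda>u. u powr c * (1 - u) powr (\<beta> - 1)) has_integral Beta (c + 1) \<beta>) (cbox 0 1)"
    by simp
  from has_integral_affinity'[OF this, of "1 / t" 0] t
  have "((\<lambda>\<tau>. (\<tau> / t) powr c * (1 - \<tau> / t) powr (\<beta> - 1)) has_integral t * Beta (c + 1) \<beta>) {0..t}"
    by (simp add: divide_inverse mult_ac)
  \<comment> \<open>Pulling \<open>t\<close> out of both powers in the integrand leaves
    \<open>t\<close> to the power \<open>1 - c - \<beta>\<close>. This factor cancels it, and
    together with the Jacobian \<open>t\<close> it produces
    \<open>t powr (c + \<beta>)\<close>.\<close>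
  from has_integral_mult_right[OF this, of "t powr (c + \<beta> - 1)"]
  have "((\<lambda>\<tau>. t powr (c + \<beta> - 1) * ((\<tau> / t) powr c * (1 - \<tau> / t) powr (\<beta> - 1)))
          has_integral t powr (c + \<beta>) * Beta (c + 1) \<beta>) {0..t}"
    using t by (simp add: powr_diff)
  moreover have "t powr (c + \<beta> - 1) * ((\<tau> / t) powr c * (1 - \<tau> / t) powr (\<beta> - 1))
        = (t - \<tau>) powr (\<beta> - 1) * \<tau> powr c" if "\<tau> \<in> {0..t}" for \<tau>
  proof -
    have "1 - \<tau> / t = (t - \<tau>) / t" using t by (simp add: field_simps)
    moreover have "t powr (c + \<beta> - 1) = t powr c * t powr (\<beta> - 1)"
      by (simp flip: powr_add add: algebra_simps)
    ultimately show ?thesis using t that by (simp add: powr_divide)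
  qed
  ultimately show ?thesis by (rule has_integral_eq[rotated]) 
qed (use assms in auto)

lemma frac_kernel_absolutely_integrable:
  fixes \<beta> t :: real
  assumes "0 < \<beta>" "0 \<le> t"
  shows "(\<lambda>\<tau>. (t - \<tau>) powr (\<beta> - 1)) absolutely_integrable_on {0..t}"
    and "integral {0..t} (\<lambda>\<tau>. (t - \<tau>) powr (\<beta> - 1)) = t powr \<beta> / \<beta>"
proof -
  have "Gamma \<beta> \<noteq> 0" using assms by (simp add: Gamma_real_nonzero)
  then have "Beta 1 \<beta> = 1 / \<beta>"
    using assms Gamma_plus1[of \<beta>]
    by (simp add: Beta_def add.commute nonpos_Ints_def)
  then have I: "((\<lambda>\<tau>. (t - \<tau>) powr (\<beta> - 1) * \<tau> powr 0) has_integral t powr \<beta> / \<beta>) {0..t}"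
    using has_integral_frac_kernel_powr[of \<beta> 0 t] assms by simp
  \<comment> \<open>\<open>\<tau> powr 0\<close> is 1 except at 0, where it is 0; a single point
    does not affect the integral.\<close>
  have "((\<lambda>\<tau>. (t - \<tau>) powr (\<beta> - 1)) has_integral t powr \<beta> / \<beta>) {0..t}"
    by (rule has_integral_spike_finite[OF _ _ I, of "{0}"]) auto
  then show "(\<lambda>\<tau>. (t - \<tau>) powr (\<beta> - 1)) absolutely_integrable_on {0..t}"
    and "integral {0..t} (\<lambda>\<tau>. (t - \<tau>) powr (\<beta> - 1)) = t powr \<beta> / \<beta>"
    by (auto simp: has_integral_iff intro: nonnegative_absolutely_integrable_1)
qed

lemma frac_kernel_mult_integrable:
  fixes \<beta> t :: real
  assumes "0 < \<beta>" "0 \<le> t" "continuous_on {0..t} y"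
  shows "(\<lambda>\<tau>. (t - \<tau>) powr (\<beta> - 1) * y \<tau>) integrable_on {0..t}"
proof -
  have "(\<lambda>\<tau>. y \<tau> * (t - \<tau>) powr (\<beta> - 1)) absolutely_integrable_on {0..t}"
    using assms
    by (intro absolutely_integrable_bounded_measurable_product_real
          continuous_imp_measurable_on_sets_lebesgue frac_kernel_absolutely_integrable
          compact_imp_bounded compact_continuous_image) auto
  then show ?thesis
    by (auto simp: mult.commute dest: set_lebesgue_integral_eq_integral(1))
qed

section \<open>Elementary properties of fractional integrals and their values on powers\<close>

lemma frac_int_0 [simp]: "frac_int 0 y = y"
  by (simp add: frac_int_def fun_eq_iff)

lemma frac_int_at_0 [simp]: "\<beta> \<noteq> 0 \<Longrightarrow> frac_int \<beta> y 0 = 0"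
  by (simp add: frac_int_def)

lemma frac_int_cong:
  assumes "0 \<le> t" "\<And>s. s \<in> {0..t} \<Longrightarrow> y s = z s"
  shows "frac_int \<beta> y t = frac_int \<beta> z t"
  unfolding frac_int_def using assms by (auto intro!: integral_cong)

lemma frac_int_diff:
  assumes "0 < \<beta>" "0 \<le> t" "continuous_on {0..t} y" "continuous_on {0..t} z"
  shows "frac_int \<beta> (\<lambda>s. y s - z s) t = frac_int \<beta> y t - frac_int \<beta> z t"
  using assms
  by (simp add: frac_int_def right_diff_distrib integral_diff frac_kernel_mult_integrable)

text \<open>This makes the fractional integral a bounded operator for the supremum norm. The kernel
  integrates to \<open>t powr \<beta> / \<beta>\<close>, and the factor \<open>1 / \<beta>\<close>
  turns \<open>Gamma \<beta>\<close> into \<open>Gamma (\<beta> + 1)\<close>.\<close>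

lemma abs_frac_int_le:
  assumes "0 < \<beta>" "0 \<le> t" "continuous_on {0..t} y" "\<And>s. s \<in> {0..t} \<Longrightarrow> \<bar>y s\<bar> \<le> M"
  shows "\<bar>frac_int \<beta> y t\<bar> \<le> M * t powr \<beta> / Gamma (\<beta> + 1)"
proof -
  have "norm (integral {0..t} (\<lambda>\<tau>. (t - \<tau>) powr (\<beta> - 1) * y \<tau>))
      \<le> integral {0..t} (\<lambda>\<tau>. M * (t - \<tau>) powr (\<beta> - 1))"
    using assms frac_kernel_absolutely_integrable[of \<beta> t]
    by (intro integral_norm_bound_integral frac_kernel_mult_integrable integrable_on_mult_right)
       (auto simp: abs_mult mult.commute intro!: mult_right_mono 
          dest: set_lebesgue_integral_eq_integral(1))
  also have "\<dots> = M * (t powr \<beta> / \<beta>)"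
    using assms by (simp add: frac_kernel_absolutely_integrable)
  finally have "norm (integral {0..t} (\<lambda>\<tau>. (t - \<tau>) powr (\<beta> - 1) * y \<tau>)) \<le> M * (t powr \<beta> / \<beta>)" .
  moreover have "Gamma \<beta> \<noteq> 0" using assms by (simp add: Gamma_real_nonzero)
  ultimately show ?thesis
    using assms Gamma_plus1[of \<beta>]
    by (simp add: frac_int_def abs_mult field_simps nonpos_Ints_def)
qed

text \<open>Expanding \<open>Beta\<close> into Gamma values cancels the normalising
  \<open>Gamma \<beta>\<close>. Real exponents are allowed because the fractional integral of a
  polynomial is again such a sum, with exponents shifted by the order; the formula can therefore be
  iterated.\<close>

lemma frac_int_powr_sum:
  fixes a e :: "'i \<Rightarrow> real"
  assumes "0 < \<beta>" "0 \<le> t" "\<And>i. i \<in> I \<Longrightarrow> 0 \<le> e i" "finite I"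
  shows "frac_int \<beta> (\<lambda>s. \<Sum>i\<in>I. a i * s powr e i) t =
           (\<Sum>i\<in>I. a i * (Gamma (e i + 1) / Gamma (e i + 1 + \<beta>)) * t powr (e i + \<beta>))"
proof -
  have "((\<lambda>\<tau>. \<Sum>i\<in>I. a i * ((t - \<tau>) powr (\<beta> - 1) * \<tau> powr e i)) has_integral
           (\<Sum>i\<in>I. a i * (t powr (e i + \<beta>) * Beta (e i + 1) \<beta>))) {0..t}"
    using assms by (intro has_integral_sum has_integral_mult_right has_integral_frac_kernel_powr) auto
  then have "integral {0..t} (\<lambda>\<tau>. (t - \<tau>) powr (\<beta> - 1) * (\<Sum>i\<in>I. a i * \<tau> powr e i)) =
           (\<Sum>i\<in>I. a i * (t powr (e i + \<beta>) * Beta (e i + 1) \<beta>))"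
    by (simp add: has_integral_iff sum_distrib_left mult_ac)
  moreover have "Gamma \<beta> \<noteq> 0" using assms by (simp add: Gamma_real_nonzero)
  ultimately show ?thesis
    using assms
    by (auto simp: frac_int_def Beta_def sum_divide_distrib sum_distrib_left mult_ac intro!: sum.cong)
qed

lemma frac_int_real_polynomial:
  fixes a :: "nat \<Rightarrow> real"
  assumes "0 < \<beta>" "0 \<le> t"
  shows "frac_int \<beta> (\<lambda>s. \<Sum>i\<le>n. a i * s ^ i) t =
           (\<Sum>i\<le>n. a i * (Gamma (i + 1) / Gamma (i + 1 + \<beta>)) * t powr (i + \<beta>))"
proof -
  have "frac_int \<beta> (\<lambda>s. \<Sum>i\<le>n. a i * s ^ i) t = frac_int \<beta> (\<lambda>s. \<Sum>i\<le>n. a i * s powr i) t"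
  proof -
    \<comment> \<open>The constant term is 1 at 0 as \<open>s ^ 0\<close> but 0 as
      \<open>s powr 0\<close>, so the integrands may differ there.\<close>
    have "integral {0..t} (\<lambda>s. (t - s) powr (\<beta> - 1) * (\<Sum>i\<le>n. a i * s ^ i)) =
          integral {0..t} (\<lambda>s. (t - s) powr (\<beta> - 1) * (\<Sum>i\<le>n. a i * s powr i))"
      by (rule integral_spike[of "{0}"]) (auto simp: powr_realpow)
    then show ?thesis using assms by (simp add: frac_int_def)
  qed
  then show ?thesis using assms by (simp add: frac_int_powr_sum)
qed

section \<open>Polynomial approximation, continuity and the semigroup law\<close>

lemma Weierstrass_uniform_limit:
  fixes v :: "real \<Rightarrow> real"
  assumes "continuous_on {a..b} v"
  obtains p where "\<And>k. real_polynomial_function (p k)" "uniform_limit {a..b} p v sequentially"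
proof -
  have "\<exists>g. real_polynomial_function g \<and> (\<forall>x\<in>{a..b}. \<bar>v x - g x\<bar> < inverse (Suc k))" for k
    using Stone_Weierstrass_real_polynomial_function[OF compact_Icc assms, of "inverse (Suc k)"]
    by (metis inverse_positive_iff_positive of_nat_0_less_iff zero_less_Suc)
  then obtain p where p: "\<And>k. real_polynomial_function (p k)"
    "\<And>k x. x \<in> {a..b} \<Longrightarrow> \<bar>v x - p k x\<bar> < inverse (Suc k)"
    by metis
  have "uniform_limit {a..b} p v sequentially"
  proof (rule uniform_limitI)
    fix e :: real assume "e > 0"
    then obtain N where N: "inverse (Suc N) < e" using reals_Archimedean by blast
    have "\<forall>x\<in>{a..b}. dist (p k x) (v x) < e" if "k \<ge> N" for k
    proof
      fix x assume "x \<in> {a..b}"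
      have "inverse (real (Suc k)) \<le> inverse (Suc N)" using that by (simp add: field_simps)
      then show "dist (p k x) (v x) < e"
        using p(2)[OF \<open>x \<in> _\<close>, of k] N by (simp only: dist_real_def abs_minus_commute)
    qed
    then show "\<forall>\<^sub>F k in sequentially. \<forall>x\<in>{a..b}. dist (p k x) (v x) < e"
      by (auto simp: eventually_sequentially)
  qed
  with p(1) show thesis by (rule that)
qed

lemma uniform_limit_frac_int:
  assumes "0 < \<beta>" "\<And>k. continuous_on {0..T} (p k)" "continuous_on {0..T} v"
    and lim: "uniform_limit {0..T} p v sequentially"
  shows "uniform_limit {0..T} (\<lambda>k. frac_int \<beta> (p k)) (frac_int \<beta> v) sequentially"
proof (rule uniform_limitI)
  fix e :: real assume e: "e > 0"
  have G: "Gamma (\<beta> + 1) > 0" using assms by (simp add: Gamma_real_pos)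
  \<comment> \<open>Chosen so that the bound of \<open>abs_frac_int_le\<close>, with
    \<open>t powr \<beta>\<close> enlarged to \<open>T powr \<beta> + 1\<close>, equals
    \<open>e\<close>. The added 1 keeps the denominator positive and makes the final inequality
    strict.\<close>
  define M where "M = e * Gamma (\<beta> + 1) / (T powr \<beta> + 1)"
  have M: "M > 0" using e G by (simp add: M_def add_nonneg_pos)
  from uniform_limitD[OF lim this]
  show "\<forall>\<^sub>F k in sequentially. \<forall>t\<in>{0..T}. dist (frac_int \<beta> (p k) t) (frac_int \<beta> v t) < e"
  proof eventually_elim
    case (elim k)
    show ?case
    proof
      fix t assume t: "t \<in> {0..T}"
      have cont: "continuous_on {0..t} (p k)" "continuous_on {0..t} v"
        using assms(2)[of k] assms(3) t by (auto intro: continuous_on_subset)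
      have "\<bar>frac_int \<beta> (\<lambda>s. p k s - v s) t\<bar> \<le> M * t powr \<beta> / Gamma (\<beta> + 1)"
        using assms t elim cont
        by (intro abs_frac_int_le continuous_intros) (auto simp: dist_real_def intro: less_imp_le)
      also have "\<dots> < M * (T powr \<beta> + 1) / Gamma (\<beta> + 1)"
        using t assms M G powr_mono2[of \<beta> t T] by (intro divide_strict_right_mono mult_strict_left_mono) auto
      also have "\<dots> = e" using G by (simp add: M_def add_nonneg_pos less_imp_neq[symmetric])
      finally show "dist (frac_int \<beta> (p k) t) (frac_int \<beta> v t) < e"
        using assms t cont by (simp add: frac_int_diff dist_real_def)
    qed
  qed
qed

text \<open>For positive order, polynomials are sent to sums of powers with positive exponents,
  which are continuous up to 0, and uniform limits preserve continuity.\<close>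

lemma continuous_on_frac_int:
  assumes "0 \<le> \<beta>" "continuous_on {0..T} v"
  shows "continuous_on {0..T} (frac_int \<beta> v)"
proof (cases "\<beta> = 0")
  case True
  then show ?thesis using assms by (simp add: frac_int_def)
next
  case False
  with assms have \<beta>: "\<beta> > 0" by simp
  obtain p where p: "\<And>k. real_polynomial_function (p k)" "uniform_limit {0..T} p v sequentially"
    using Weierstrass_uniform_limit[OF assms(2)] by blast
  have cont: "continuous_on {0..T} (p k)" for k
    using p(1) by (simp add: continuous_on_polymonial_function real_polynomial_function_eq)
  have "continuous_on {0..T} (frac_int \<beta> (p k))" for k
  proof -
    obtain a n where "p k = (\<lambda>x. \<Sum>i\<le>n. a i * x ^ i)"
      using p(1) real_polynomial_function_iff_sum by blast
    moreover have "continuous_on {0..T}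
        (\<lambda>t. \<Sum>i\<le>n. a i * (Gamma (real i + 1) / Gamma (real i + 1 + \<beta>)) * t powr (real i + \<beta>))"
      using \<beta> by (intro continuous_intros continuous_on_powr') auto
    ultimately show ?thesis
      using \<beta> by (auto simp: frac_int_real_polynomial elim!: continuous_on_eq)
  qed
  then show ?thesis
    using uniform_limit_theorem[OF _ uniform_limit_frac_int[OF \<beta> cont assms(2) p(2)]] by simp
qed

text \<open>Both sides are continuous in \<open>v\<close> for uniform convergence, so it is enough to compare them on
  polynomials.\<close>
lemma frac_int_frac_int:
  assumes "0 < \<alpha>" "0 < \<beta>" "0 \<le> t" "continuous_on {0..t} v"
  shows "frac_int \<alpha> (frac_int \<beta> v) t = frac_int (\<beta> + \<alpha>) v t"
proof -
  obtain p where p: "\<And>k. real_polynomial_function (p k)" "uniform_limit {0..t} p v sequentially"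
    using Weierstrass_uniform_limit[OF assms(4)] by blast
  have cont: "continuous_on {0..t} (p k)" for k
    using p(1) by (simp add: continuous_on_polymonial_function real_polynomial_function_eq)
  have eq: "frac_int \<alpha> (frac_int \<beta> (p k)) t = frac_int (\<beta> + \<alpha>) (p k) t" for k
  proof -
    obtain a n where a: "p k = (\<lambda>x. \<Sum>i\<le>n. a i * x ^ i)"
      using p(1) real_polynomial_function_iff_sum by blast
    have "frac_int \<alpha> (frac_int \<beta> (p k)) t = frac_int \<alpha>
        (\<lambda>s. \<Sum>i\<le>n. a i * (Gamma (real i + 1) / Gamma (real i + 1 + \<beta>)) * s powr (real i + \<beta>)) t"
      using assms unfolding a by (intro frac_int_cong frac_int_real_polynomial) auto
    also have "\<dots> = frac_int (\<beta> + \<alpha>) (p k) t"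
    proof -
      \<comment> \<open>The coefficients from the two integrations share this Gamma value, once as
        denominator and once as numerator; cancelling it gives the coefficient of order
        \<open>\<beta> + \<alpha>\<close>.\<close>
      have "Gamma (real i + 1 + \<beta>) \<noteq> 0" for i using assms by (simp add: Gamma_real_nonzero)
      then show ?thesis
        using assms unfolding a
        by (subst frac_int_powr_sum[where e = "\<lambda>i. real i + \<beta>"])
           (auto simp: frac_int_real_polynomial add_ac intro!: sum.cong)
    qed
    finally show ?thesis .
  qed
  \<comment> \<open>The inner integrals converge uniformly and are continuous, as the outer limit
    theorem requires of its integrands.\<close>
  have lim: "(\<lambda>k. frac_int \<alpha> (frac_int \<beta> (p k)) t) \<longlonglongrightarrow> frac_int \<alpha> (frac_int \<beta> v) t"
    using assms cont p
    by (intro tendsto_uniform_limitI[OF uniform_limit_frac_int] uniform_limit_frac_int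
          continuous_on_frac_int) auto
  have "(\<lambda>k. frac_int (\<beta> + \<alpha>) (p k) t) \<longlonglongrightarrow> frac_int (\<beta> + \<alpha>) v t"
    using assms cont p by (intro tendsto_uniform_limitI[OF uniform_limit_frac_int]) auto
  with lim[unfolded eq] show ?thesis by (rule LIMSEQ_unique)
qed

section \<open>Differentiation of fractional integrals\<close>

lemma frac_int_1:
  assumes "0 \<le> t"
  shows "frac_int 1 y t = integral {0..t} y"
proof -
  \<comment> \<open>The kernel of order 1 is 1 except at \<open>\<tau> = t\<close>, where
    \<open>0 powr 0\<close> is 0.\<close>
  have "integral {0..t} (\<lambda>\<tau>. (t - \<tau>) powr (1 - 1) * y \<tau>) = integral {0..t} y"
    by (rule integral_spike[of "{t}"]) auto
  then show ?thesis by (simp add: frac_int_def)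
qed

text \<open>By the semigroup law with outer order 1, the left-hand function is the ordinary integral
  of the continuous function \<open>frac_int \<beta> v\<close>, so the fundamental theorem of
  calculus applies, also at the end points.\<close>

lemma frac_int_has_vector_derivative:
  assumes "0 \<le> \<beta>" "continuous_on {0..T} v" "t \<in> {0..T}"
  shows "(frac_int (\<beta> + 1) v has_vector_derivative frac_int \<beta> v t) (at t within {0..T})"
proof -
  have eq: "integral {0..s} (frac_int \<beta> v) = frac_int (\<beta> + 1) v s" if "s \<in> {0..T}" for s
  proof (cases "\<beta> = 0")
    case True
    then show ?thesis using that by (simp add: frac_int_1)
  next
    case False
    have "continuous_on {0..s} v" using that assms by (auto intro: continuous_on_subset)
    then show ?thesis using False assms that frac_int_frac_int[of 1 \<beta> s v] by (simp add: frac_int_1)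
  qed
  have "((\<lambda>s. integral {0..s} (frac_int \<beta> v)) has_vector_derivative frac_int \<beta> v t) (at t within {0..T})"
    using assms by (intro integral_has_vector_derivative continuous_on_frac_int)
  from this assms(3) show ?thesis
    by (rule has_vector_derivative_transform[rotated 2]) (simp add: eq)
qed

section \<open>Derivatives and Caputo derivatives on the unit interval\<close>

lemma deriv01_eqI:
  assumes "(x has_vector_derivative d) (at t within {0..1})" "t \<in> {0..1}"
  shows "deriv01 x t = d"
  unfolding deriv01_def
  using vector_derivative_within_cbox[of 0 1 t x d] assms by simp

lemma deriv01_frac_int_affine:
  fixes c d :: real
  assumes "1 < q" "continuous_on {0..1} v" "t \<in> {0..1}"
  defines "x \<equiv> \<lambda>s. frac_int q v s - c - d * s"
  shows "(x has_vector_derivative frac_int (q - 1) v t - d) (at t within {0..1})"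
    and "deriv01 x t = frac_int (q - 1) v t - d"
proof -
  have "(frac_int q v has_vector_derivative frac_int (q - 1) v t) (at t within {0..1})"
    using frac_int_has_vector_derivative[of "q - 1" 1 v t] assms by simp
  then show *: "(x has_vector_derivative frac_int (q - 1) v t - d) (at t within {0..1})"
    unfolding x_def by (auto intro!: derivative_eq_intros)
  from * assms(3) show "deriv01 x t = frac_int (q - 1) v t - d" by (rule deriv01_eqI)
qed

lemma C1_01_frac_int_affine:
  assumes "1 < q" "continuous_on {0..1} v"
  shows "C1_01 (\<lambda>t. frac_int q v t - c - d * t)"
proof -
  have "continuous_on {0..1} (\<lambda>t. frac_int (q - 1) v t - d)"
    using assms by (intro continuous_intros continuous_on_frac_int) auto
  then have "continuous_on {0..1} (deriv01 (\<lambda>t. frac_int q v t - c - d * t))"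
    by (rule continuous_on_eq) (use assms in \<open>simp add: deriv01_frac_int_affine\<close>)
  then show ?thesis
    unfolding C1_01_def differentiable_on_def
    using deriv01_frac_int_affine(1)[OF assms, of _ c d] differentiableI_vector by blast
qed

lemma caputo_frac_int_affine:
  fixes c d :: real
  assumes "1 < q" "\<beta> \<le> q" "\<beta> \<le> 2" "continuous_on {0..1} v"
  defines "x \<equiv> \<lambda>t. frac_int q v t - c - d * t"
  shows "caputo_exists_on \<beta> x {0..1}"
    and "t \<in> {0..1} \<Longrightarrow> caputo \<beta> x t = frac_int (q - \<beta>) v t"
proof -
  let ?P = "caputo_potential \<beta> x"
  \<comment> \<open>Since \<open>q > 1\<close>, the fractional integrals of orders \<open>q\<close>
    and \<open>q - 1\<close> both vanish at 0. Hence \<open>x 0 = - c\<close> and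
    \<open>deriv01 x 0 = - d\<close>, and the subtracted Taylor polynomial is exactly the affine
    part of \<open>x\<close>.\<close>
  have x0: "x s - x 0 - deriv01 x 0 * s = frac_int q v s" for s
    using assms deriv01_frac_int_affine(2)[of q v 0 c d] by (simp add: x_def)
  have P: "?P s = frac_int (q - \<beta> + 2) v s" if "s \<in> {0..1}" for s
  \<comment> \<open>The semigroup law is stated for positive orders; for \<open>\<beta> = 2\<close>
    the outer integral is the identity.\<close>
  proof (cases "\<beta> = 2")
    case True
    then show ?thesis by (simp add: caputo_potential_def x0)
  next
    case False
    have "continuous_on {0..s} v" using that assms by (auto intro: continuous_on_subset)
    then show ?thesis
      using False assms(1,3) that frac_int_frac_int[of "2 - \<beta>" q s v]
      by (simp add: caputo_potential_def x0 add.commute add_diff_eq diff_add_eq)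
  qed
  \<comment> \<open>Each of the two differentiations lowers the order by 1. The last order reached
    is \<open>q - \<beta>\<close>, nonnegative because \<open>\<beta> \<le> q\<close>.\<close>
  have P1: "(?P has_vector_derivative frac_int (q - \<beta> + 1) v s) (at s within {0..1})"
    if "s \<in> {0..1}" for s
    using frac_int_has_vector_derivative[of "q - \<beta> + 1" 1 v s] assms that P
    by (intro has_vector_derivative_transform[of s "{0..1}" ?P "frac_int (q - \<beta> + 2) v"])
       (auto simp: algebra_simps)
  have D: "deriv01 ?P s = frac_int (q - \<beta> + 1) v s" if "s \<in> {0..1}" for s
    using deriv01_eqI[OF P1] that by blast
  have P2: "(deriv01 ?P has_vector_derivative frac_int (q - \<beta>) v s) (at s within {0..1})"
    if "s \<in> {0..1}" for s
    using frac_int_has_vector_derivative[of "q - \<beta>" 1 v s] assms that D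
    by (intro has_vector_derivative_transform[of s "{0..1}" "deriv01 ?P" "frac_int (q - \<beta> + 1) v"]) auto
  show "caputo_exists_on \<beta> x {0..1}"
    unfolding caputo_exists_on_def using P1 P2 differentiableI_vector by blast
  show "caputo \<beta> x t = frac_int (q - \<beta>) v t" if "t \<in> {0..1}"
    unfolding caputo_def using deriv01_eqI[OF P2] that by blast
qed

section \<open>The two constants and the boundary value problem\<close>

lemma integral_frac_kernels:
  assumes "1 < q" "continuous_on {0..1} v"
  shows "integral {0..1} (\<lambda>s. (a * (1 - s) powr (q - 1) / (c * Gamma q)
           + b * (1 - s) powr (q - 2) / (d * Gamma (q - 1))) * v s) =
         a / c * frac_int q v 1 + b / d * frac_int (q - 1) v 1"
proof -
  \<comment> \<open>\<open>?k r\<close> is the kernel of order \<open>r\<close> evaluated at time 1.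
    The free coefficients let one computation serve both constants and the explicit formula for the
    solution.\<close>
  let ?k = "\<lambda>r s. (1 - s) powr (r - 1) * v s"
  have int: "?k q integrable_on {0..1}" "?k (q - 1) integrable_on {0..1}"
    using assms frac_kernel_mult_integrable[of q 1 v] frac_kernel_mult_integrable[of "q - 1" 1 v]
    by simp_all
  have "integral {0..1} (\<lambda>s. (a * (1 - s) powr (q - 1) / (c * Gamma q)
           + b * (1 - s) powr (q - 2) / (d * Gamma (q - 1))) * v s) =
        integral {0..1} (\<lambda>s. a / (c * Gamma q) * ?k q s + b / (d * Gamma (q - 1)) * ?k (q - 1) s)"
    by (simp add: algebra_simps)
  also have "\<dots> = a / (c * Gamma q) * integral {0..1} (?k q)
        + b / (d * Gamma (q - 1)) * integral {0..1} (?k (q - 1))"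
    using int by (subst integral_add) (simp_all only: integrable_on_mult_right integral_mult_right)
  also have "\<dots> = a / c * frac_int q v 1 + b / d * frac_int (q - 1) v 1"
    using assms by (simp add: frac_int_def)
  finally show ?thesis .
qed

lemma bvp_b1_eq:
  assumes "1 < q" "continuous_on {0..1} v"
  shows "bvp_b1 A B \<eta>1 \<eta>2 q v =
    - (B / A * frac_int q v 1 + B\<^sup>2 / A\<^sup>2 * frac_int (q - 1) v 1) - ((A + B) * \<eta>1 - B * \<eta>2) / A\<^sup>2"
  unfolding bvp_b1_def integral_frac_kernels[OF assms] ..

lemma bvp_b2_eq:
  assumes "1 < q" "continuous_on {0..1} v"
  shows "bvp_b2 A B \<eta>1 \<eta>2 q v =
    frac_int q v 1 + B / A * frac_int (q - 1) v 1 - (\<eta>2 - \<eta>1) / A"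
  unfolding bvp_b2_def using integral_frac_kernels[OF assms, of 1 1 B A] by simp

theorem lemma5:
  fixes q A B \<eta>1 \<eta>2 :: real
    and qs :: "'n::{finite,linorder} \<Rightarrow> real"
    and f :: "real \<times> real \<times> (real ^ 'n::{finite,linorder}) \<Rightarrow> real"
    and v :: "real \<Rightarrow> real"
  assumes "1 < q" and "q \<le> 2"
    and "\<And>i. qs i < q"
    and "\<And>i j. i < j \<Longrightarrow> qs j < qs i"
    and "\<And>i. 1 < qs i"
    and "A \<noteq> 0"
    and "continuous_on ({0..1} \<times> UNIV) f"
    and "continuous_on {0..1} v"
    and "\<And>t. t \<in> {0..1} \<Longrightarrow>
           v t = f (t, frac_int q v t
                      - bvp_b1 A B \<eta>1 \<eta>2 q v - bvp_b2 A B \<eta>1 \<eta>2 q v * t,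
                    \<chi> i. frac_int (q - qs i) v t)"
  shows "bvp_solution A B \<eta>1 \<eta>2 q qs f
           (\<lambda>t. frac_int q v t
              + integral {0..1} (\<lambda>s. ((B - A * t) * (1 - s) powr (q - 1) / (A * Gamma q)
                    + B * (B - A * t) * (1 - s) powr (q - 2) / (A^2 * Gamma (q - 1))) * v s)
              + 1 / A^2 * ((A * (1 - t) + B) * \<eta>1 + (- B + A * t) * \<eta>2))"
proof -
  define b1 where "b1 = bvp_b1 A B \<eta>1 \<eta>2 q v"
  define b2 where "b2 = bvp_b2 A B \<eta>1 \<eta>2 q v"
  define x where "x = (\<lambda>t. frac_int q v t - b1 - b2 * t)"
  note b1 = b1_def[unfolded bvp_b1_eq[OF assms(1,8)]]
  note b2 = b2_def[unfolded bvp_b2_eq[OF assms(1,8)]]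
  have x_eq: "(\<lambda>t. frac_int q v t
      + integral {0..1} (\<lambda>s. ((B - A * t) * (1 - s) powr (q - 1) / (A * Gamma q)
            + B * (B - A * t) * (1 - s) powr (q - 2) / (A^2 * Gamma (q - 1))) * v s)
      + 1 / A^2 * ((A * (1 - t) + B) * \<eta>1 + (- B + A * t) * \<eta>2)) = x"
    (is "?y = x")
  proof
    fix t
    \<comment> \<open>\<open>I\<close> and \<open>J\<close> stand for the fractional integrals of
      \<open>v\<close> of orders \<open>q\<close> and \<open>q - 1\<close> at 1. With these as
      unknowns, the explicit formula and \<open>- b1 - b2 * t\<close> agree as rational
      expressions.\<close>
    have "(B - A * t) / A * I + B * (B - A * t) / A\<^sup>2 * J
        + 1 / A^2 * ((A * (1 - t) + B) * \<eta>1 + (- B + A * t) * \<eta>2) =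
      - (- (B / A * I + B\<^sup>2 / A\<^sup>2 * J) - ((A + B) * \<eta>1 - B * \<eta>2) / A\<^sup>2)
        - (I + B / A * J - (\<eta>2 - \<eta>1) / A) * t" for I J
      using \<open>A \<noteq> 0\<close>
      by (simp add: add_divide_distrib diff_divide_distrib power2_eq_square algebra_simps)
    from this[of "frac_int q v 1" "frac_int (q - 1) v 1"] show "?y t = x t"
      unfolding integral_frac_kernels[OF assms(1,8)] x_def b1 b2 by linarith
  qed
  have dx: "deriv01 x t = frac_int (q - 1) v t - b2" if "t \<in> {0..1}" for t
    unfolding x_def using assms that by (intro deriv01_frac_int_affine)
  have exists_on: "caputo_exists_on \<beta> x {0..1}" if "\<beta> \<le> q" for \<beta>
    unfolding x_def using assms that by (intro caputo_frac_int_affine) auto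
  have caputo: "caputo \<beta> x t = frac_int (q - \<beta>) v t" if "\<beta> \<le> q" "t \<in> {0..1}" for \<beta> t
    unfolding x_def using assms that by (intro caputo_frac_int_affine) auto
  have "C1_01 x"
    unfolding x_def using assms by (intro C1_01_frac_int_affine)
  \<comment> \<open>For \<open>\<beta> = q\<close> the remaining order is 0, so
    \<open>caputo q x\<close> coincides with \<open>v\<close> on the unit interval.\<close>
  moreover have "continuous_on {0..1} (caputo q x)"
    by (rule continuous_on_eq[OF assms(8)]) (simp add: caputo)
  moreover have "caputo_exists_on (qs i) x {0<..<1}" for i
    using exists_on[of "qs i"] assms(3)[of i] by (auto simp: caputo_exists_on_def)
  moreover have "caputo q x t = f (t, x t, \<chi> i. caputo (qs i) x t)" if "t \<in> {0<..<1}" for t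
  proof -
    have "x t = frac_int q v t - bvp_b1 A B \<eta>1 \<eta>2 q v - bvp_b2 A B \<eta>1 \<eta>2 q v * t"
      by (simp add: x_def b1_def b2_def)
    then show ?thesis
      using assms(9)[of t] assms(3) that by (simp add: caputo less_imp_le)
  qed
  moreover have "A * x 0 + B * deriv01 x 0 = \<eta>1"
  proof -
    have "x 0 = - b1" "deriv01 x 0 = - b2"
      using assms(1) dx[of 0] by (simp_all add: x_def)
    \<comment> \<open>The contributions of the integrals to \<open>A * b1\<close> and
      \<open>B * b2\<close> are opposite, so only the boundary data remain.\<close>
    moreover have "A * (- b1) + B * (- b2) = \<eta>1"
      unfolding b1 b2 using \<open>A \<noteq> 0\<close> by (simp add: field_simps power2_eq_square)
    ultimately show ?thesis by simp
  qed
  moreover have "A * x 1 + B * deriv01 x 1 = \<eta>2"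
  proof -
    have "x 1 = frac_int q v 1 - b1 - b2" "deriv01 x 1 = frac_int (q - 1) v 1 - b2"
      using dx[of 1] by (simp_all add: x_def)
    \<comment> \<open>Subtracting the condition at 0 leaves \<open>A * frac_int q v 1 + B * frac_int
      (q - 1) v 1 - A * b2 = \<eta>2 - \<eta>1\<close>, which is what determines \<open>b2\<close>;
      the condition at 0 then determines \<open>b1\<close>.\<close>
    moreover have "A * (frac_int q v 1 - b1 - b2) + B * (frac_int (q - 1) v 1 - b2) = \<eta>2"
      unfolding b1 b2 using \<open>A \<noteq> 0\<close> by (simp add: field_simps power2_eq_square)
    ultimately show ?thesis by simp
  qed
  ultimately show ?thesis
    unfolding bvp_solution_def x_eq using exists_on[of q] by blast
qed

end
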